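(* Every function $f:\mathbb{R}\to\mathbb{R}$ that is Baire 1 and locally almost continuous is continuous.
   Context: All topological notions refer to the usual topology of $\mathbb{R}$. $f$ is Baire 1 if it is the pointwise limit of a sequence of continuous functions $\mathbb{R}\to\mathbb{R}$. $f$ is locally almost continuous if for every $x\in\mathbb{R}$ and every neighborhood $V$ of $f(x)$ one has $x\in\operatorname{Int}(\overline{f^{-1}(V)})$. *)

theory Defs
  imports "HOL-Analysis.Analysis"
begin

definition baire_one :: "(real \<Rightarrow> real) \<Rightarrow> bool" where
  "baire_one f \<longleftrightarrow>
     (\<exists>g :: nat \<Rightarrow> real \<Rightarrow> real.
        (\<forall>n. continuous_on UNIV (g n)) \<and> (\<forall>x. (\<lambda>n. g n x) \<longlonglongrightarrow> f x))"

text \<open>Neighborhoods need not be open: \<open>V\<close> is a neighborhood of \<open>y\<close> iff \<open>y \<in> interior V\<close>.\<close>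

definition locally_almost_continuous :: "(real \<Rightarrow> real) \<Rightarrow> bool" where
  "locally_almost_continuous f \<longleftrightarrow>
     (\<forall>x V. f x \<in> interior V \<longrightarrow> x \<in> interior (closure (f -` V)))"

end

theory Submission
  imports Defs
begin

text \<open>
  If \<open>f\<close> jumps by at least \<open>e\<close> at points \<open>y\<close> arbitrarily close to \<open>x\<close>, then local almost continuity,
  applied first at \<open>x\<close> and then at such a point \<open>y\<close> inside the open set obtained from \<open>x\<close>, yields
  a nonempty open set \<open>W\<close> on which values near \<open>f x\<close> and values near \<open>f y\<close> are both taken densely.
  A pointwise limit of continuous functions cannot behave like this
  (\<open>no_limit_densely_low_and_high\<close>). The points of \<open>W\<close> at which the approximating functions
  are low infinitely often form a dense \<open>G\<^sub>\<delta>\<close> set, and so do the points at which they are high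
  infinitely often. By the Baire category theorem some point lies in both sets, and the
  approximating sequence cannot converge there.
\<close>

text \<open>
  The Baire category theorem localised to an open set: adding the exterior of \<open>W\<close> to each
  set of the family makes it dense in the whole space without changing it on \<open>W\<close>.
\<close>

lemma open_meets_Inter_locally_dense:
  fixes W :: "'a :: {real_normed_vector, heine_borel} set"
  assumes "open W" "W \<noteq> {}" and "countable \<G>"
    and \<G>: "\<And>T. T \<in> \<G> \<Longrightarrow> open T \<and> W \<subseteq> closure T"
  shows "W \<inter> \<Inter>\<G> \<noteq> {}"
proof -
  let ?\<H> = "(\<lambda>T. T \<union> - closure W) ` \<G>"
  have "UNIV \<subseteq> closure (\<Inter>?\<H>)"
  proof (rule Baire)
    fix H assume "H \<in> ?\<H>"
    then obtain T where T: "T \<in> \<G>" and H: "H = T \<union> - closure W"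
      by blast
    have "closure W \<subseteq> closure T"
      using \<G>[OF T] by (simp add: closure_minimal)
    then have "UNIV \<subseteq> closure H"
      using closure_subset[of "- closure W"] unfolding H closure_Un by blast
    moreover have "open H"
      unfolding H using \<G>[OF T] by auto
    ultimately show "openin (top_of_set UNIV) H \<and> UNIV \<subseteq> closure H"
      by simp
  qed (use \<open>countable \<G>\<close> in auto)
  then have "W \<inter> \<Inter>?\<H> \<noteq> {}"
    using open_Int_closure_eq_empty[OF \<open>open W\<close>] \<open>W \<noteq> {}\<close> by blast
  then show ?thesis
    using closure_subset[of W] by blast
qed

text \<open>
  Strict inequalities for the limit pass to all late approximants, so the points at which
  \<open>g n x < a\<close> for infinitely many \<open>n\<close> contain \<open>{x. f x < a}\<close>; unlike that set, they always
  form a \<open>G\<^sub>\<delta>\<close> set. The same holds for \<open>b\<close>, which makes Baire's theorem applicable.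
\<close>

lemma no_limit_densely_low_and_high:
  fixes f :: "'a :: {real_normed_vector, heine_borel} \<Rightarrow> real"
  assumes cont: "\<And>n. continuous_on UNIV (g n)"
    and lim: "\<And>x. (\<lambda>n. g n x) \<longlonglongrightarrow> f x"
    and W: "open W" "W \<noteq> {}" and "a < b"
    and low: "W \<subseteq> closure {x. f x < a}"
    and high: "W \<subseteq> closure {x. f x > b}"
  shows False
proof -
  define L where "L N = (\<Union>n\<in>{N..}. {x. g n x < a})" for N
  define H where "H N = (\<Union>n\<in>{N..}. {x. g n x > b})" for N
  have "open (L N)" "open (H N)" for N
    unfolding L_def H_def by (auto intro!: open_Collect_less cont)
  moreover have "{x. f x < a} \<subseteq> L N" for N
  proof
    fix x assume "x \<in> {x. f x < a}"
    then have "\<forall>\<^sub>F n in sequentially. g n x < a"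
      using order_tendstoD(2)[OF lim] by simp
    then show "x \<in> L N"
      unfolding L_def eventually_sequentially by (metis (mono_tags) UN_iff atLeast_iff max.cobounded1 max.cobounded2 mem_Collect_eq)
  qed
  moreover have "{x. f x > b} \<subseteq> H N" for N
  proof
    fix x assume "x \<in> {x. f x > b}"
    then have "\<forall>\<^sub>F n in sequentially. g n x > b"
      using order_tendstoD(1)[OF lim] by simp
    then show "x \<in> H N"
      unfolding H_def eventually_sequentially by (metis (mono_tags) UN_iff atLeast_iff max.cobounded1 max.cobounded2 mem_Collect_eq)
  qed
  ultimately have "open (L N) \<and> W \<subseteq> closure (L N)" "open (H N) \<and> W \<subseteq> closure (H N)" for N
    using low high by (meson closure_mono order_trans)+
  then have "W \<inter> \<Inter>(range L \<union> range H) \<noteq> {}"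
    using W by (intro open_meets_Inter_locally_dense) auto
  then obtain z where "\<And>N. z \<in> L N" "\<And>N. z \<in> H N"
    by blast
  then have freq: "\<exists>\<^sub>F n in sequentially. g n z < a" "\<exists>\<^sub>F n in sequentially. g n z > b"
    unfolding L_def H_def frequently_sequentially by fastforce+
  have "f z \<le> a"
  proof (rule ccontr)
    assume "\<not> f z \<le> a"
    then have "\<forall>\<^sub>F n in sequentially. a < g n z"
      using order_tendstoD(1)[OF lim] by simp
    then have "\<forall>\<^sub>F n in sequentially. \<not> g n z < a"
      by (rule eventually_mono) simp
    then show False
      using freq(1) by (simp add: frequently_def)
  qed
  moreover have "f z \<ge> b"
  proof (rule ccontr)
    assume "\<not> f z \<ge> b"
    then have "\<forall>\<^sub>F n in sequentially. g n z < b"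
      using order_tendstoD(2)[OF lim] by simp
    then have "\<forall>\<^sub>F n in sequentially. \<not> g n z > b"
      by (rule eventually_mono) simp
    then show False
      using freq(2) by (simp add: frequently_def)
  qed
  ultimately show False
    using \<open>a < b\<close> by simp
qed

theorem theorem5p1:
  fixes f :: "real \<Rightarrow> real"
  assumes "baire_one f"
    and "locally_almost_continuous f"
  shows "continuous_on UNIV f"
proof (rule ccontr)
  obtain g :: "nat \<Rightarrow> real \<Rightarrow> real" where cont: "\<And>n. continuous_on UNIV (g n)"
    and lim: "\<And>x. (\<lambda>n. g n x) \<longlonglongrightarrow> f x"
    using assms(1) unfolding baire_one_def by blast
  define D where "D x r = interior (closure (f -` ball (f x) r))" for x r
  have D: "x \<in> D x r" if "r > 0" for x r
    using assms(2) that unfolding locally_almost_continuous_def D_def by simp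
  assume "\<not> continuous_on UNIV f"
  then obtain x e where "e > 0" and jump: "\<And>d. d > 0 \<Longrightarrow> \<exists>y. dist y x < d \<and> \<not> dist (f y) (f x) < e"
    unfolding continuous_on_iff by auto
  \<comment> \<open>Balls of radius \<open>e / 4\<close> around two values at distance at least \<open>e\<close> leave a gap of positive length.\<close>
  define r where "r = e / 4"
  have "r > 0"
    using \<open>e > 0\<close> by (simp add: r_def)
  obtain d where "d > 0" "ball x d \<subseteq> D x r"
    using D[OF \<open>r > 0\<close>, of x] open_contains_ball[of "D x r"] by (auto simp: D_def)
  obtain y where y: "dist y x < d" "\<not> dist (f y) (f x) < e"
    using jump[OF \<open>d > 0\<close>] by blast
  have "y \<in> D x r"
    using y(1) \<open>ball x d \<subseteq> D x r\<close> by (auto simp: dist_commute)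
  have far: "dist (f y) (f x) \<ge> 4 * r"
    using y(2) by (simp add: r_def)
  define W where "W = D x r \<inter> D y r"
  have W: "open W" "W \<noteq> {}"
    using \<open>y \<in> D x r\<close> D[OF \<open>r > 0\<close>, of y] by (auto simp: W_def D_def)
  have dense: "W \<subseteq> closure A" if "f -` ball (f x) r \<subseteq> A \<or> f -` ball (f y) r \<subseteq> A" for A
    using that closure_mono interior_subset unfolding W_def D_def by blast
  consider "f x + 4 * r \<le> f y" | "f y + 4 * r \<le> f x"
    using far unfolding dist_real_def by linarith
  then show False
  proof cases
    case 1
    show False
    proof (rule no_limit_densely_low_and_high[OF cont lim W])
      show "f x + r < f y - r"
        using 1 \<open>r > 0\<close> by simp
    qed (rule dense, force simp: dist_real_def)+
  next
    case 2
    show False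
    proof (rule no_limit_densely_low_and_high[OF cont lim W])
      show "f y + r < f x - r"
        using 2 \<open>r > 0\<close> by simp
    qed (rule dense, force simp: dist_real_def)+
  qed
qed

end
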